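(* Let $\lambda\in\mathbb{Z}_p$ with $\lambda\neq0$, so that $x/\lambda$ is defined, and let $x\in\mathbb{C}_p$. For every integer $m\ge0$, \[ \sum_{n=0}^{m}Bl_n(x|\lambda)\,S_2(m,n)=\frac{1}{2}E_m\!\left(\frac{x}{\lambda}\right)\lambda^m . \]
   Context: The Boole polynomials $Bl_n(x|\lambda)$ are defined by \[ \sum_{n=0}^{\infty}Bl_n(x|\lambda)\frac{t^n}{n!}=\frac{1}{1+(1+t)^{\lambda}}(1+t)^x, \] with $(1+t)^a=\sum_{n\ge0}\binom{a}{n}t^n$. The Euler polynomials $E_n(x)$ are defined by $\frac{2}{e^t+1}e^{xt}=\sum_{n\ge0}E_n(x)\frac{t^n}{n!}$. The Stirling numbers of the second kind $S_2(l,n)$ are defined by $(e^t-1)^n=n!\sum_{l\ge n}S_2(l,n)\frac{t^l}{l!}$. *)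

theory Defs
  imports
    "HOL-Analysis.Abstract_Metric_Spaces"
    "HOL-Computational_Algebra.Computational_Algebra"
    "HOL-Combinatorics.Stirling"
begin

section \<open>The field of p-adic complex numbers\<close>

text \<open>
  The libraries contain no p-adic numbers. We describe \<open>\<complex>\<^sub>p\<close> by the defining properties of
  the completion of an algebraic closure of the completion \<open>\<rat>\<^sub>p\<close> of \<open>\<rat>\<close>. They determine
  the valued field up to isometric isomorphism. The absolute value is an explicit parameter, because
  the type class of normed fields in the library is limited to real algebras.
\<close>

locale ultrametric_field =
  fixes nrm :: "'a::field_char_0 \<Rightarrow> real"
  assumes nrm_nonneg: "0 \<le> nrm x"
    and nrm_eq_0_iff: "nrm x = 0 \<longleftrightarrow> x = 0"
    and nrm_mult: "nrm (x * y) = nrm x * nrm y"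
    and nrm_add_le: "nrm (x + y) \<le> max (nrm x) (nrm y)"
begin

lemma nrm_minus: "nrm (- x) = nrm x"
proof -
  have "nrm (- x) ^ 2 = nrm x ^ 2"
    by (metis nrm_mult power2_eq_square minus_mult_minus)
  then show ?thesis
    by (metis nrm_nonneg power2_eq_iff_nonneg)
qed

sublocale Metric_space UNIV "\<lambda>x y. nrm (x - y)"
proof
  fix x y z :: 'a
  show "0 \<le> nrm (x - y)" by (rule nrm_nonneg)
  show "nrm (x - y) = nrm (y - x)" by (metis nrm_minus minus_diff_eq)
  show "nrm (x - y) = 0 \<longleftrightarrow> x = y" by (simp add: nrm_eq_0_iff)
  show "nrm (x - z) \<le> nrm (x - y) + nrm (y - z)"
    using nrm_add_le[of "x - y" "y - z"] nrm_nonneg[of "x - y"] nrm_nonneg[of "y - z"] by simp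
qed

text \<open>In a complete field with \<open>nrm p = 1 / p\<close>, the closure of \<open>\<rat>\<close> is the p-adic completion of \<open>\<rat>\<close>.\<close>

definition Qp :: "'a set" where
  "Qp = mtopology closure_of \<rat>"

definition Zp :: "'a set" where
  "Zp = {x \<in> Qp. nrm x \<le> 1}"

definition Qp_bar :: "'a set" where
  "Qp_bar = {x. \<exists>f. f \<noteq> 0 \<and> (\<forall>i. coeff f i \<in> Qp) \<and> poly f x = 0}"

end

locale padic_complex_field = ultrametric_field nrm
  for p :: nat and nrm :: "'a::field_char_0 \<Rightarrow> real" +
  assumes prime_p: "prime p"
    and nrm_p: "nrm (of_nat p) = 1 / real p"
    and complete: "mcomplete"
    and Qp_bar_closed:
      "degree f > 0 \<Longrightarrow> (\<forall>i. coeff f i \<in> Qp_bar) \<Longrightarrow> \<exists>x \<in> Qp_bar. poly f x = 0"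
    and Qp_bar_dense: "mtopology closure_of Qp_bar = UNIV"

section \<open>Boole polynomials, Euler polynomials and Stirling numbers\<close>

text \<open>
  \<^const>\<open>fps_binomial\<close> \<open>a\<close> is \<open>(1 + t)\<^sup>a\<close> with coefficients \<open>a gchoose n\<close>, and \<^const>\<open>fps_exp\<close> \<open>a\<close>
  is \<open>e\<^sup>a\<^sup>t\<close>. Both denominators below have constant coefficient 2, hence are invertible.
\<close>

definition Boole :: "nat \<Rightarrow> 'a::field_char_0 \<Rightarrow> 'a \<Rightarrow> 'a" where
  "Boole n x l = fact n * fps_nth (1 / (1 + fps_binomial l) * fps_binomial x) n"

definition Euler :: "nat \<Rightarrow> 'a::field_char_0 \<Rightarrow> 'a" where
  "Euler n x = fact n * fps_nth (2 / (fps_exp 1 + 1) * fps_exp x) n"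

lemma Boole_genfun:
  "Abs_fps (\<lambda>n. Boole n x l / fact n) = 1 / (1 + fps_binomial l) * fps_binomial x"
  by (rule fps_ext) (simp add: Boole_def)

lemma Euler_genfun:
  "Abs_fps (\<lambda>n. Euler n x / fact n) = 2 / (fps_exp 1 + 1) * fps_exp x"
  by (rule fps_ext) (simp add: Euler_def)

text \<open>
  \<^const>\<open>Stirling\<close> is defined in the library by its recurrence; its terms vanish for \<open>l < n\<close>.
  It agrees with the definition by the generating function.
\<close>

lemma Stirling_genfun:
  "(fps_exp (1::'a::field_char_0) - 1) ^ n =
     fps_const (fact n) * Abs_fps (\<lambda>l. of_nat (Stirling l n) / fact l)"
proof -
  define G :: "nat \<Rightarrow> 'a fps" where "G n = (fps_exp 1 - 1) ^ n" for n
  have deriv: "fps_deriv (G (Suc n)) = of_nat (Suc n) * (G (Suc n) + G n)" for n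
  proof -
    have "fps_deriv (fps_exp (1::'a) - 1) = (fps_exp 1 - 1) + 1"
      by simp
    then show ?thesis
      unfolding G_def fps_deriv_power' by (simp add: algebra_simps del: of_nat_Suc)
  qed
  have step: "of_nat (Suc l) * fps_nth (G (Suc n)) (Suc l)
      = of_nat (Suc n) * (fps_nth (G (Suc n)) l + fps_nth (G n) l)" for n l
    using arg_cong[OF deriv[of n], of "\<lambda>F. fps_nth F l"]
    by (simp add: fps_of_nat[symmetric] del: of_nat_Suc)
  have "fps_nth (G n) l = fact n * of_nat (Stirling l n) / fact l" for l
  proof (induction l n rule: Stirling.induct)
    case (4 l n)
    have "of_nat (Suc l) * fps_nth (G (Suc n)) (Suc l) =
        of_nat (Suc n) * (fact (Suc n) * of_nat (Stirling l (Suc n)) / fact l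
          + fact n * of_nat (Stirling l n) / fact l)"
      unfolding step 4 ..
    also have "\<dots> = fact (Suc n) * of_nat (Stirling (Suc l) (Suc n)) / fact l"
      by (simp add: field_simps)
    finally show ?case
      by (simp add: field_simps del: of_nat_Suc Stirling.simps)
  qed (simp_all add: G_def)
  then show ?thesis
    by (intro fps_ext) (simp add: G_def)
qed

end

theory Submission
  imports Defs
begin

text \<open>
  Substituting \<open>e\<^sup>t - 1\<close> for \<open>t\<close> turns \<open>(1 + t)\<^sup>a\<close> into \<open>e\<^sup>a\<^sup>t\<close>, so it turns the generating
  function of the Boole polynomials into \<open>e\<^sup>x\<^sup>t / (1 + e\<^sup>l\<^sup>t)\<close>. This is half the generating function
  of the Euler polynomials at \<open>x / l\<close>, evaluated at \<open>l t\<close>. On coefficients, the substitution is the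
  Stirling transform.
\<close>

lemma fps_binomial_compose_exp:
  "fps_binomial (a::'a::field_char_0) oo (fps_exp 1 - 1) = fps_exp a"
proof -
  let ?E = "fps_exp 1 - 1 :: 'a fps"
  have E0: "fps_nth ?E 0 = 0" by simp
  have "fps_deriv (fps_binomial a) * (1 + fps_X) = fps_const a * fps_binomial a"
    by (simp add: fps_binomial_deriv fps_divide_unit mult.assoc inverse_mult_eq_1)
  then have "(fps_deriv (fps_binomial a) * (1 + fps_X)) oo ?E = (fps_const a * fps_binomial a) oo ?E"
    by simp
  then have "(fps_deriv (fps_binomial a) oo ?E) * fps_exp 1 = fps_const a * (fps_binomial a oo ?E)"
    by (simp add: fps_compose_mult_distrib[OF E0] fps_compose_add_distrib)
  then have "fps_deriv (fps_binomial a oo ?E) = fps_const a * (fps_binomial a oo ?E)"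
    by (simp add: fps_compose_deriv[OF E0])
  then have "fps_binomial a oo ?E = fps_const (fps_nth (fps_binomial a oo ?E) 0) * fps_exp a"
    by (simp only: fps_exp_unique_ODE)
  then show ?thesis by simp
qed

lemma Stirling_transform_eq_compose:
  "(\<Sum>n=0..m. fact n * fps_nth f n * of_nat (Stirling m n))
     = fact m * fps_nth (f oo (fps_exp 1 - 1)) m" for f :: "'a::field_char_0 fps"
  by (simp add: fps_compose_nth Stirling_genfun sum_distrib_left mult_ac)

theorem theorem2:
  fixes p m :: nat and nrm :: "'a::field_char_0 \<Rightarrow> real" and x l :: 'a
  assumes "padic_complex_field p nrm"
    and "l \<in> ultrametric_field.Zp nrm"
    and "l \<noteq> 0"
  shows "(\<Sum>n=0..m. Boole n x l * of_nat (Stirling m n)) = 1 / 2 * Euler m (x / l) * l ^ m"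
proof -
  let ?E = "fps_exp 1 - 1 :: 'a fps" and ?L = "fps_const l * fps_X"
  have E0: "fps_nth ?E 0 = 0" and L0: "fps_nth ?L 0 = 0" by simp_all
  have boole: "(1 / (1 + fps_binomial l) * fps_binomial x) oo ?E = fps_exp x / (1 + fps_exp l)"
    by (simp add: fps_compose_mult_distrib[OF E0] fps_inverse_compose[OF E0]
        fps_compose_add_distrib fps_binomial_compose_exp fps_divide_unit mult_ac)
  have euler: "(2 / (fps_exp 1 + 1) * fps_exp (x / l)) oo ?L = 2 * (fps_exp x / (1 + fps_exp l))"
    using \<open>l \<noteq> 0\<close>
    by (simp add: fps_compose_mult_distrib[OF L0] fps_inverse_compose[OF L0]
        fps_compose_add_distrib fps_divide_unit numeral_fps_const)
      (simp add: mult_ac add_ac)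
  have "(\<Sum>n=0..m. Boole n x l * of_nat (Stirling m n))
      = fact m * fps_nth (fps_exp x / (1 + fps_exp l)) m"
    unfolding Boole_def Stirling_transform_eq_compose boole ..
  moreover have "Euler m (x / l) * l ^ m = fact m * fps_nth (2 * (fps_exp x / (1 + fps_exp l))) m"
    unfolding Euler_def euler[symmetric] by (simp only: fps_nth_compose_linear mult.assoc mult.commute[of "l ^ m"])
  ultimately show ?thesis
    by (simp add: numeral_fps_const)
qed

end
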